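(* Let $q$ be a prime power and let $f_1,\dots,f_t\colon\mathbb{F}_q^n\to\mathbb{F}_q$ be polynomials of degrees $d_1,\dots,d_t$ respectively. Let $k$ be the least integer satisfying \[ n\le k+\sum_{i=1}^{t}(d_i+1)\cdot\sum_{j=0}^{d_i-1}(d_i-j)\binom{k+j-1}{j}. \] Then for every $u_0\in\mathbb{F}_q^n$ there exists a linear subspace $U\subseteq\mathbb{F}_q^n$ of dimension $k$ such that for all $i\in[t]$, $f_i$ restricted to $u_0+U$ is constant. In particular, if $d_1,\dots,d_t\le d$ then $k=\Omega((n/t)^{1/(d-1)})$. Moreover, for $d\le\log(n/t)/10$, $k=\Omega(d\cdot(n/t)^{1/(d-1)})$.
   Context: Degree of a function on $\mathbb{F}_q^n$ means the total degree of its unique polynomial representation with individual degrees at most $q-1$. Logarithms are to base 2. Constants in $\Omega$ are universal. *)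

theory Defs
  imports "HOL-Analysis.Analysis" "HOL-Library.Poly_Mapping"
begin

text \<open>
  An element of type \<open>('n \<Rightarrow>\<^sub>0 nat) \<Rightarrow>\<^sub>0 'a\<close> is a polynomial in variables indexed by \<open>'n\<close>:
  it maps each exponent vector to its coefficient.
\<close>

definition poly_eval :: "(('n::finite \<Rightarrow>\<^sub>0 nat) \<Rightarrow>\<^sub>0 'a::field) \<Rightarrow> 'a ^ 'n \<Rightarrow> 'a"
  where "poly_eval P x =
    (\<Sum>m\<in>Poly_Mapping.keys P.
       Poly_Mapping.lookup P m * (\<Prod>i\<in>UNIV. (x $ i) ^ Poly_Mapping.lookup m i))"

definition reduced :: "(('n::finite \<Rightarrow>\<^sub>0 nat) \<Rightarrow>\<^sub>0 'a::{field,finite}) \<Rightarrow> bool"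
  where "reduced P \<longleftrightarrow>
    (\<forall>m\<in>Poly_Mapping.keys P. \<forall>i. Poly_Mapping.lookup m i \<le> CARD('a) - 1)"

text \<open>Over a finite field, every function has exactly one reduced representation.\<close>

definition reduced_rep ::
    "('a::{field,finite} ^ 'n::finite \<Rightarrow> 'a) \<Rightarrow> (('n \<Rightarrow>\<^sub>0 nat) \<Rightarrow>\<^sub>0 'a)"
  where "reduced_rep f = (THE P. reduced P \<and> (\<forall>x. f x = poly_eval P x))"

text \<open>The zero function gets degree \<open>0\<close>.\<close>

definition fun_degree :: "('a::{field,finite} ^ 'n::finite \<Rightarrow> 'a) \<Rightarrow> nat"
  where "fun_degree f =
    Max (insert 0 ((\<lambda>m. \<Sum>i\<in>UNIV. Poly_Mapping.lookup m i) ` Poly_Mapping.keys (reduced_rep f)))"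

text \<open>
  The least \<open>k\<close> is taken over the natural numbers. The subtraction \<open>k + j - 1\<close> truncates only
  for \<open>k = j = 0\<close>, where the value \<open>0 choose 0 = 1\<close> agrees with the usual convention that
  \<open>x\<close> choose \<open>0\<close> is \<open>1\<close> for every \<open>x\<close>, including \<open>x = -1\<close>.
\<close>

definition subspace_dim :: "nat \<Rightarrow> nat \<Rightarrow> (nat \<Rightarrow> nat) \<Rightarrow> nat"
  where "subspace_dim n t d =
    (LEAST k. n \<le> k + (\<Sum>i=1..t. (d i + 1) * (\<Sum>j<d i. (d i - j) * ((k + j - 1) choose j))))"

end

theory Submission
  imports Defs "HOL-Library.Multiset"
begin

text \<open>
  The subspace is built one dimension at a time. Suppose all \<open>f i\<close> are constant on
  \<open>u + span B\<close>, and let \<open>W\<close> span a complement of \<open>span B\<close>. Expand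
  \<open>f i (u + \<Sum>v\<in>B. y v *s v + a *s x)\<close> with \<open>x \<in> span W\<close> as a polynomial in \<open>y\<close> and \<open>a\<close>.
  The coefficient of \<open>y\<^sup>m a\<^sup>b\<close> is a homogeneous form of degree \<open>b\<close> in \<open>x\<close>, where
  \<open>size m + b \<le> d i\<close>; a common zero \<open>x \<noteq> 0\<close> of all those with \<open>b \<ge> 1\<close> can be added to \<open>B\<close>.
  Since \<open>x = 0\<close> is a common zero, Chevalley's theorem provides another one as long as the
  degrees add up to less than \<open>n - card B\<close>.

  For the asymptotic bounds, the inner sum \<open>\<Sum>j<d. (d - j) * ((k + j - 1) choose j)\<close> equals
  \<open>(k + d) choose (d - 1)\<close> when \<open>k \<ge> 1\<close>, which is at most \<open>(k + 2)\<^bsup>d - 1\<^esup>\<close>, and at most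
  \<open>(2 e k / (d - 1))\<^bsup>d - 1\<^esup>\<close> once \<open>k \<ge> d\<close>.
\<close>

section \<open>Finite fields\<close>

text \<open>Multiplication by \<open>x\<close> permutes the nonzero elements, so their product is
  unchanged when every factor is multiplied by \<open>x\<close>; this nonzero product can be
  cancelled.\<close>

lemma finite_field_power_card_minus_1:
  fixes x :: "'a::{field,finite}"
  assumes "x \<noteq> 0"
  shows "x ^ (CARD('a) - 1) = 1"
proof -
  have "(\<Prod>y\<in>UNIV - {0}. x * y) = (\<Prod>y\<in>UNIV - {0}. y)"
    by (rule prod.reindex_bij_witness[of _ "\<lambda>y. y / x" "\<lambda>y. x * y"]) (use assms in auto)
  then have "x ^ (CARD('a) - 1) * \<Prod>(UNIV - {0}) = 1 * \<Prod>(UNIV - {0 :: 'a})"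
    by (simp add: prod.distrib)
  moreover have "\<Prod>(UNIV - {0 :: 'a}) \<noteq> 0"
    by simp
  ultimately show ?thesis
    using mult_right_cancel by blast
qed

lemma card_field_ge_2: "2 \<le> CARD('a::{field,finite})"
proof -
  have "card {0, 1 :: 'a} \<le> CARD('a)"
    by (intro card_mono) auto
  then show ?thesis by simp
qed

text \<open>For m > 0 the polynomial X^m - 1 has at most m roots, fewer than there are nonzero
  elements, so b^m differs from 1 for some nonzero b. Substituting b x for x multiplies the sum by
  b^m without changing it.\<close>

lemma finite_field_sum_power_eq_0:
  assumes "m < CARD('a) - 1"
  shows "(\<Sum>x\<in>UNIV. x ^ m) = (0 :: 'a::{field,finite})"
proof (cases "m = 0")
  case True
  \<comment> \<open>Translation by 1 permutes the field, so the sum of \<open>CARD('a)\<close> ones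
    is zero.\<close>
  have "(\<Sum>x\<in>UNIV. x + 1) = (\<Sum>x\<in>UNIV. x :: 'a)"
    by (rule sum.reindex_bij_witness[of _ "\<lambda>x. x - 1" "\<lambda>x. x + 1"]) auto
  then show ?thesis
    using True by (simp add: sum.distrib)
next
  case False
  define p where "p = monom (1 :: 'a) m - 1"
  have "coeff p m = 1"
    using False by (simp add: p_def)
  then have "p \<noteq> 0"
    by auto
  moreover have "degree p \<le> m"
    unfolding p_def by (intro degree_diff_le) (auto simp: degree_monom_le)
  ultimately have "card {x. poly p x = 0} \<le> m"
    using card_poly_roots_bound le_trans by blast
  then have "card {x. poly p x = 0} < card (UNIV - {0 :: 'a})"
    using assms by simp
  then have "\<not> UNIV - {0 :: 'a} \<subseteq> {x. poly p x = 0}"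
    using card_mono[OF finite, of "UNIV - {0 :: 'a}" "{x. poly p x = 0}"] by linarith
  then obtain b where "b \<noteq> 0" "poly p b \<noteq> 0"
    by blast
  then have b: "b \<noteq> 0" "b ^ m \<noteq> 1"
    by (simp_all add: p_def poly_monom)
  have "(\<Sum>x\<in>UNIV. (b * x) ^ m) = (\<Sum>x\<in>UNIV. x ^ m)"
    by (rule sum.reindex_bij_witness[of _ "\<lambda>x. x / b" "\<lambda>x. b * x"]) (use b in auto)
  then have "(b ^ m - 1) * (\<Sum>x\<in>UNIV. x ^ m) = 0"
    by (auto simp: power_mult_distrib simp flip: sum_distrib_left)
  with b show ?thesis by simp
qed

section \<open>Polynomial functions and Chevalley's theorem\<close>

text \<open>Multisets act as exponent vectors: \<open>size\<close> is the total degree, multiset sum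
  is multiplication of monomials, and counting monomials becomes counting multisets of a given
  size.\<close>

definition monomial :: "'i multiset \<Rightarrow> ('i \<Rightarrow> 'a) \<Rightarrow> 'a::comm_monoid_mult"
  where "monomial m y = (\<Prod>i\<in>#m. y i)"

lemma monomial_empty [simp]: "monomial {#} y = 1"
  and monomial_add_mset [simp]: "monomial (add_mset i m) y = y i * monomial m y"
  and monomial_plus [simp]: "monomial (m + m') y = monomial m y * monomial m' y"
  by (simp_all add: monomial_def)

lemma monomial_cong: "(\<And>i. i \<in># m \<Longrightarrow> y i = z i) \<Longrightarrow> monomial m y = monomial m z"
  unfolding monomial_def by (metis image_mset_cong)

lemma monomial_scale:
  "monomial m (\<lambda>i. a * y i) = a ^ size m * (monomial m y :: 'a::comm_semiring_1)"
  by (induction m) (auto simp: algebra_simps)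

lemma monomial_eq_prod:
  assumes "finite I" "set_mset m \<subseteq> I"
  shows "monomial m y = (\<Prod>i\<in>I. (y i :: 'a::comm_semiring_1) ^ count m i)"
proof -
  have "monomial m y = (\<Prod>i\<in>set_mset m. y i ^ count m i)"
    by (simp add: monomial_def image_prod_mset_multiplicity)
  also have "\<dots> = (\<Prod>i\<in>I. y i ^ count m i)"
    using assms by (intro prod.mono_neutral_left) (auto simp: not_in_iff)
  finally show ?thesis .
qed

definition multisets_upto :: "'i set \<Rightarrow> nat \<Rightarrow> 'i multiset set"
  where "multisets_upto I d = {m. set_mset m \<subseteq> I \<and> size m \<le> d}"

lemma multisets_upto_eq_UN: "multisets_upto I d = (\<Union>j\<le>d. multisets_of_size I j)"
  by (auto simp: multisets_upto_def multisets_of_size_def)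

lemma finite_multisets_upto: "finite I \<Longrightarrow> finite (multisets_upto I d)"
  by (auto simp: multisets_upto_eq_UN intro: finite_multisets_of_size)

lemma sum_multisets_upto_size:
  fixes h :: "nat \<Rightarrow> nat"
  assumes "finite I"
  shows "(\<Sum>m\<in>multisets_upto I d. h (size m)) = (\<Sum>j\<le>d. ((card I + j - 1) choose j) * h j)"
proof -
  have "(\<Sum>m\<in>multisets_upto I d. h (size m))
      = (\<Sum>j\<le>d. \<Sum>m\<in>multisets_of_size I j. h (size m))"
    unfolding multisets_upto_eq_UN using assms
    by (intro sum.UNION_disjoint)
      (blast, blast intro: finite_multisets_of_size, auto simp: multisets_of_size_def)
  also have "\<dots> = (\<Sum>j\<le>d. \<Sum>m\<in>multisets_of_size I j. h j)"
    by (intro sum.cong refl) (auto simp: multisets_of_size_def)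
  finally show ?thesis
    using assms by (simp add: card_multisets_of_size)
qed

text \<open>Here \<open>d\<close> only bounds the degree of some representation of the function,
  with exponents of any size allowed. This keeps degree bounds stable under sums, products and
  substitution by rule induction.\<close>

inductive polyfun :: "'i set \<Rightarrow> nat \<Rightarrow> (('i \<Rightarrow> 'a) \<Rightarrow> 'a::field) \<Rightarrow> bool" for I d
  where
  polyfun_monomial:
    "set_mset m \<subseteq> I \<Longrightarrow> size m \<le> d \<Longrightarrow> polyfun I d (\<lambda>y. k * monomial m y)"
| polyfun_add: "polyfun I d F \<Longrightarrow> polyfun I d G \<Longrightarrow> polyfun I d (\<lambda>y. F y + G y)"

section \<open>Closure properties of functions of bounded degree\<close>

lemma polyfun_const: "polyfun I d (\<lambda>_. k)"
  using polyfun_monomial[of "{#}" I d k] by simp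

lemma polyfun_coord: "i \<in> I \<Longrightarrow> polyfun I 1 (\<lambda>y. k * y i)"
  using polyfun_monomial[of "{#i#}" I 1 k] by simp

lemma polyfun_mono: "polyfun I d F \<Longrightarrow> d \<le> e \<Longrightarrow> polyfun I e F"
  by (induction rule: polyfun.induct) (auto intro: polyfun.intros)

lemma polyfun_sum: "(\<And>x. x \<in> A \<Longrightarrow> polyfun I d (F x)) \<Longrightarrow> polyfun I d (\<lambda>y. \<Sum>x\<in>A. F x y)"
  by (induction A rule: infinite_finite_induct) (auto intro: polyfun_const polyfun_add)

lemma polyfun_mult_monomial:
  assumes "polyfun I e G" "set_mset m \<subseteq> I" "size m \<le> d"
  shows "polyfun I (d + e) (\<lambda>y. k * monomial m y * G y)"
  using assms(1)
proof (induction rule: polyfun.induct)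
  case (polyfun_monomial m' k')
  have "polyfun I (d + e) (\<lambda>y. (k * k') * monomial (m + m') y)"
    using polyfun_monomial assms by (intro polyfun.intros) auto
  then show ?case by (simp add: mult_ac)
next
  case (polyfun_add F G)
  then show ?case
    by (simp add: distrib_left polyfun.polyfun_add)
qed

lemma polyfun_mult:
  assumes "polyfun I d F" "polyfun I e G"
  shows "polyfun I (d + e) (\<lambda>y. F y * G y)"
  using assms(1)
  by (induction rule: polyfun.induct)
    (auto simp: distrib_right intro: polyfun_mult_monomial[OF assms(2)] polyfun_add)

lemma polyfun_power: "polyfun I d F \<Longrightarrow> polyfun I (d * e) (\<lambda>y. F y ^ e)"
  by (induction e) (auto intro: polyfun_const dest: polyfun_mult)

lemma polyfun_prod:
  assumes "\<And>x. x \<in> A \<Longrightarrow> polyfun I (d x) (F x)"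
  shows "polyfun I (\<Sum>x\<in>A. d x) (\<lambda>y. \<Prod>x\<in>A. F x y)"
  using assms
  by (induction A rule: infinite_finite_induct) (auto intro: polyfun_const polyfun_mult)

lemma polyfun_one_minus: "polyfun I d F \<Longrightarrow> polyfun I d (\<lambda>y. 1 - F y)"
  using polyfun_add[OF polyfun_const[where k = 1] polyfun_mult_monomial[of I d F "{#}" 0 "- 1"]]
  by simp

lemma polyfun_coeffs:
  assumes "polyfun I d F" "finite I"
  obtains g where "\<And>y. F y = (\<Sum>m\<in>multisets_upto I d. g m * monomial m y)"
proof -
  have "\<exists>g. \<forall>y. F y = (\<Sum>m\<in>multisets_upto I d. g m * monomial m y)"
    using assms(1)
  proof (induction rule: polyfun.induct)
    case (polyfun_monomial m k)
    then have "m \<in> multisets_upto I d"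
      by (simp add: multisets_upto_def)
    then show ?case
      using finite_multisets_upto[OF assms(2)]
      by (intro exI[of _ "\<lambda>m'. if m' = m then k else 0"])
        (simp add: if_distrib[of "\<lambda>x. x * _"] sum.delta' cong: if_cong)
  next
    case (polyfun_add F G)
    then obtain g h where "\<forall>y. F y = (\<Sum>m\<in>multisets_upto I d. g m * monomial m y)"
      "\<forall>y. G y = (\<Sum>m\<in>multisets_upto I d. h m * monomial m y)"
      by blast
    then show ?case
      by (intro exI[of _ "\<lambda>m. g m + h m"]) (simp add: distrib_right sum.distrib)
  qed
  then show ?thesis
    using that by blast
qed

text \<open>A monomial of degree below (q - 1) |I| has some exponent below q - 1. Its sum over all
  points factors into one-variable power sums, and the factor for that exponent vanishes.\<close>

lemma sum_polyfun_eq_0: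
  fixes F :: "('i \<Rightarrow> 'a::{field,finite}) \<Rightarrow> 'a"
  assumes "polyfun I d F" "finite I" "d < (CARD('a) - 1) * card I"
  shows "(\<Sum>y\<in>I \<rightarrow>\<^sub>E UNIV. F y) = 0"
  using assms(1)
proof (induction rule: polyfun.induct)
  case (polyfun_monomial m k)
  have "\<exists>i\<in>I. count m i < CARD('a) - 1"
  proof (rule ccontr)
    assume "\<not> ?thesis"
    then have "(\<Sum>i\<in>I. CARD('a) - 1) \<le> (\<Sum>i\<in>I. count m i)"
      by (intro sum_mono) auto
    also have "\<dots> = size m"
      using polyfun_monomial assms(2)
      by (subst size_multiset_overloaded_eq, intro sum.mono_neutral_right)
        (auto simp: count_eq_zero_iff)
    finally show False
      using polyfun_monomial assms(3) by (simp add: mult.commute)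
  qed
  then have "(\<Prod>i\<in>I. \<Sum>x\<in>UNIV. (x :: 'a) ^ count m i) = 0"
    using assms(2) finite_field_sum_power_eq_0 by auto
  then have "(\<Sum>y\<in>I \<rightarrow>\<^sub>E UNIV. monomial m y :: 'a) = 0"
    using assms(2) polyfun_monomial by (simp add: prod_sum_PiE monomial_eq_prod)
  then show ?case
    by (simp flip: sum_distrib_left)
qed (simp add: sum.distrib)

text \<open>The product \<open>P\<close> of the 1 - g_j^(q-1) is the indicator of the common zeros.
  Its degree is below (q - 1) |I|, so its values sum to zero; were the origin the only common zero,
  the sum would be 1.\<close>

theorem chevalley:
  fixes g :: "'j \<Rightarrow> ('i \<Rightarrow> 'a::{field,finite}) \<Rightarrow> 'a"
  assumes "finite I" "finite J"
    and g: "\<And>j. j \<in> J \<Longrightarrow> polyfun I (d j) (g j)"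
    and lt: "(\<Sum>j\<in>J. d j) < card I"
    and zero: "\<And>j. j \<in> J \<Longrightarrow> g j (\<lambda>i\<in>I. 0) = 0"
  obtains y i where "i \<in> I" "y i \<noteq> 0" "\<And>j. j \<in> J \<Longrightarrow> g j y = 0"
proof -
  define z where "z = (\<lambda>i\<in>I. 0 :: 'a)"
  define q1 where "q1 = CARD('a) - 1"
  define P where "P = (\<lambda>y. \<Prod>j\<in>J. 1 - g j y ^ q1)"
  have q1: "q1 > 0"
    using card_field_ge_2[where 'a='a] by (simp add: q1_def)
  have P: "P y = (if \<forall>j\<in>J. g j y = 0 then 1 else 0)" for y
  proof (cases "\<forall>j\<in>J. g j y = 0")
    case False
    then obtain j where "j \<in> J" "1 - g j y ^ q1 = 0"
      by (auto simp: q1_def dest: finite_field_power_card_minus_1)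
    then show ?thesis
      using False \<open>finite J\<close> by (auto simp: P_def)
  qed (use q1 in \<open>simp add: P_def zero_power\<close>)
  have "\<exists>y\<in>I \<rightarrow>\<^sub>E UNIV. y \<noteq> z \<and> P y \<noteq> 0"
  proof (rule ccontr)
    assume *: "\<not> ?thesis"
    have "polyfun I (\<Sum>j\<in>J. d j * q1) P"
      unfolding P_def using g by (intro polyfun_prod polyfun_one_minus polyfun_power)
    moreover have "(\<Sum>j\<in>J. d j * q1) < (CARD('a) - 1) * card I"
      using mult_strict_right_mono[OF lt q1] by (simp add: q1_def sum_distrib_right mult.commute)
    ultimately have "(\<Sum>y\<in>I \<rightarrow>\<^sub>E UNIV. P y) = 0"
      using sum_polyfun_eq_0 \<open>finite I\<close> by blast
    moreover have "(\<Sum>y\<in>I \<rightarrow>\<^sub>E UNIV. P y) = (\<Sum>y\<in>{z}. P y)"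
      using * \<open>finite I\<close> by (intro sum.mono_neutral_right) (auto simp: z_def intro!: finite_PiE)
    moreover have "P z = 1"
      using zero by (simp add: P z_def)
    ultimately show False by simp
  qed
  then obtain y where y: "y \<in> I \<rightarrow>\<^sub>E UNIV" "y \<noteq> z" "P y \<noteq> 0" by blast
  have "\<exists>i\<in>I. y i \<noteq> 0"
  proof (rule ccontr)
    assume "\<not> ?thesis"
    then have "y = z"
      using y(1) by (intro ext) (auto simp: z_def PiE_def extensional_def)
    with y(2) show False ..
  qed
  with y(3) that show ?thesis
    by (auto simp: P split: if_splits)
qed

section \<open>Reduced representations\<close>

text \<open>A reduced polynomial is determined by its coefficients at the q^n exponent vectors in
  \<open>M\<close>, which leaves at most q^(q^n) possibilities, exactly the number of
  functions.\<close>

lemma finite_reduced: "finite {P :: ('n::finite \<Rightarrow>\<^sub>0 nat) \<Rightarrow>\<^sub>0 'a::{field,finite}. reduced P}"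
  and card_reduced_le:
    "card {P :: ('n::finite \<Rightarrow>\<^sub>0 nat) \<Rightarrow>\<^sub>0 'a::{field,finite}. reduced P} \<le> CARD('a ^ 'n \<Rightarrow> 'a)"
proof -
  define M where "M = (UNIV :: 'n set) \<rightarrow>\<^sub>E {..CARD('a) - 1}"
  define coeffs where "coeffs = (\<lambda>P :: ('n \<Rightarrow>\<^sub>0 nat) \<Rightarrow>\<^sub>0 'a.
    \<lambda>m\<in>M. Poly_Mapping.lookup P (Abs_poly_mapping m))"
  have inj: "inj_on coeffs {P. reduced P}"
  proof (rule inj_onI)
    fix P Q :: "('n \<Rightarrow>\<^sub>0 nat) \<Rightarrow>\<^sub>0 'a"
    assume PQ: "P \<in> {P. reduced P}" "Q \<in> {P. reduced P}" and eq: "coeffs P = coeffs Q"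
    show "P = Q"
    proof (rule poly_mapping_eqI)
      fix m
      show "Poly_Mapping.lookup P m = Poly_Mapping.lookup Q m"
      proof (cases "Poly_Mapping.lookup m \<in> M")
        case True
        then show ?thesis
          using fun_cong[OF eq, of "Poly_Mapping.lookup m"]
          by (simp add: coeffs_def Poly_Mapping.lookup_inverse)
      next
        case False
        then have "m \<notin> Poly_Mapping.keys P" "m \<notin> Poly_Mapping.keys Q"
          using PQ by (auto simp: M_def reduced_def)
        then show ?thesis
          by (simp add: in_keys_iff)
      qed
    qed
  qed
  have fin: "finite M"
    by (auto simp: M_def intro!: finite_PiE)
  then have fin': "finite (M \<rightarrow>\<^sub>E (UNIV :: 'a set))"
    by (auto intro!: finite_PiE)
  have sub: "coeffs ` {P. reduced P} \<subseteq> M \<rightarrow>\<^sub>E UNIV"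
    by (auto simp: coeffs_def)
  show "finite {P :: ('n \<Rightarrow>\<^sub>0 nat) \<Rightarrow>\<^sub>0 'a. reduced P}"
    using inj sub fin' by (meson finite_imageD finite_subset)
  have "card {P :: ('n \<Rightarrow>\<^sub>0 nat) \<Rightarrow>\<^sub>0 'a. reduced P} \<le> card (M \<rightarrow>\<^sub>E (UNIV :: 'a set))"
    using inj sub fin' by (rule card_inj_on_le)
  also have "\<dots> = CARD('a) ^ (CARD('a) ^ CARD('n))"
    using fin by (simp add: card_funcsetE M_def)
  also have "\<dots> = CARD('a ^ 'n \<Rightarrow> 'a)"
    by (simp add: card_fun)
  finally show "card {P :: ('n \<Rightarrow>\<^sub>0 nat) \<Rightarrow>\<^sub>0 'a. reduced P} \<le> CARD('a ^ 'n \<Rightarrow> 'a)" .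
qed

section \<open>Evaluation and interpolation\<close>

lemma poly_eval_eq_sum:
  assumes "finite M" "Poly_Mapping.keys P \<subseteq> M"
  shows "poly_eval P x =
    (\<Sum>m\<in>M. Poly_Mapping.lookup P m * (\<Prod>i\<in>UNIV. (x $ i) ^ Poly_Mapping.lookup m i))"
  unfolding poly_eval_def using assms
  by (intro sum.mono_neutral_left) (auto simp: in_keys_iff)

lemma poly_eval_zero [simp]: "poly_eval 0 x = 0"
  by (simp add: poly_eval_def)

lemma poly_eval_single:
  "poly_eval (Poly_Mapping.single m k) x = k * (\<Prod>i\<in>UNIV. (x $ i) ^ Poly_Mapping.lookup m i)"
  by (cases "k = 0") (simp_all add: poly_eval_def)

lemma poly_eval_plus: "poly_eval (P + Q) x = poly_eval P x + poly_eval Q x"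
  using Poly_Mapping.keys_add[of P Q]
  by (simp add: poly_eval_eq_sum[of "Poly_Mapping.keys P \<union> Poly_Mapping.keys Q"]
      lookup_add distrib_right sum.distrib)

lemma reduced_plus: "reduced P \<Longrightarrow> reduced Q \<Longrightarrow> reduced (P + Q)"
  using Poly_Mapping.keys_add[of P Q] by (auto simp: reduced_def)

lemma poly_eval_sum: "poly_eval (\<Sum>x\<in>A. P x) y = (\<Sum>x\<in>A. poly_eval (P x) y)"
  by (induction A rule: infinite_finite_induct) (auto simp: poly_eval_plus)

lemma reduced_sum: "(\<And>x. x \<in> A \<Longrightarrow> reduced (P x)) \<Longrightarrow> reduced (\<Sum>x\<in>A. P x)"
proof (induction A rule: infinite_finite_induct)
  case (insert x A)
  then show ?case by (simp add: reduced_plus)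
qed (auto simp: reduced_def)

text \<open>The product of the 1 - (x_i - a_i)^(q-1) is 1 at \<open>a\<close> and 0 elsewhere, and
  has degree at most q - 1 in each variable.\<close>

lemma reduced_indicator:
  fixes a :: "'a::{field,finite} ^ 'n::finite"
  obtains P where "reduced P" "\<And>x. poly_eval P x = (if x = a then k else 0)"
proof -
  define q1 where "q1 = CARD('a) - 1"
  have q1: "q1 > 0"
    using card_field_ge_2[where 'a='a] by (simp add: q1_def)
  define p where "p i = 1 - [:- (a $ i), 1:] ^ q1" for i
  have deg: "degree (p i) \<le> q1" for i
    unfolding p_def
    by (intro degree_diff_le) (simp_all add: degree_linear_power)
  have p: "poly (p i) z = (if z = a $ i then 1 else 0)" for i z
    using finite_field_power_card_minus_1[of "z - a $ i"] q1
    by (auto simp: p_def q1_def)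
  define M where "M = (UNIV :: 'n set) \<rightarrow>\<^sub>E {..q1}"
  \<comment> \<open>The coefficients come from expanding the product of the univariate
    \<open>p i\<close> by distributivity, scaled by \<open>k\<close>.\<close>
  define P where "P = (\<Sum>m\<in>M. Poly_Mapping.single (Abs_poly_mapping m)
    (k * (\<Prod>i\<in>UNIV. coeff (p i) (m i))))"
  have "reduced P"
    unfolding P_def by (intro reduced_sum) (auto simp: reduced_def M_def q1_def)
  moreover have "poly_eval P x = (if x = a then k else 0)" for x
  proof -
    have "poly_eval P x = k * (\<Sum>m\<in>M. \<Prod>i\<in>UNIV. coeff (p i) (m i) * x $ i ^ m i)"
      by (simp add: P_def poly_eval_sum poly_eval_single prod.distrib sum_distrib_left mult_ac)
    also have "\<dots> = k * (\<Prod>i\<in>UNIV. \<Sum>e\<le>q1. coeff (p i) e * x $ i ^ e)"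
      by (simp add: M_def prod_sum_PiE)
    also have "\<dots> = k * (\<Prod>i\<in>UNIV. poly (p i) (x $ i))"
    proof -
      have "(\<Sum>e\<le>q1. coeff (p i) e * x $ i ^ e) = poly (p i) (x $ i)" for i
        unfolding poly_altdef using deg[of i]
        by (intro sum.mono_neutral_right) (auto intro: coeff_eq_0)
      then show ?thesis by simp
    qed
    also have "\<dots> = (if x = a then k else 0)"
      by (auto simp: p vec_eq_iff)
    finally show ?thesis .
  qed
  ultimately show ?thesis
    using that by blast
qed

lemma reduced_rep_exists:
  fixes f :: "'a::{field,finite} ^ 'n::finite \<Rightarrow> 'a"
  obtains P where "reduced P" "\<And>x. f x = poly_eval P x"
proof -
  have "\<forall>a. \<exists>P. reduced P \<and> (\<forall>x. poly_eval P x = (if x = a then f a else 0))"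
    using reduced_indicator by metis
  then obtain P where "\<And>a. reduced (P a)"
    and "\<And>a x. poly_eval (P a) x = (if x = a then f a else 0)"
    by metis
  then show ?thesis
    using that[of "\<Sum>a\<in>UNIV. P a"] by (simp add: reduced_sum poly_eval_sum)
qed

text \<open>Uniqueness is a counting argument: there are at most as many reduced polynomials as
  functions, and every function is represented.\<close>

lemma reduced_rep:
  fixes f :: "'a::{field,finite} ^ 'n::finite \<Rightarrow> 'a"
  shows "reduced (reduced_rep f)" "f x = poly_eval (reduced_rep f) x"
proof -
  let ?R = "{P :: ('n \<Rightarrow>\<^sub>0 nat) \<Rightarrow>\<^sub>0 'a. reduced P}"
  have "poly_eval ` ?R = UNIV"
  proof (intro equalityI subset_UNIV subsetI)
    fix g :: "'a ^ 'n \<Rightarrow> 'a"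
    obtain P where "reduced P" "\<And>x. g x = poly_eval P x"
      using reduced_rep_exists[of g] by blast
    then show "g \<in> poly_eval ` ?R"
      by (intro image_eqI[of _ _ P]) auto
  qed
  moreover have "card (poly_eval ` ?R) \<le> card ?R"
    by (rule card_image_le[OF finite_reduced])
  ultimately have "inj_on poly_eval ?R"
    using card_reduced_le[where 'n='n and 'a='a] finite_reduced
    by (intro eq_card_imp_inj_on) auto
  then have "\<exists>!P. reduced P \<and> (\<forall>x. f x = poly_eval P x)"
  proof -
    obtain P where P: "reduced P" "\<And>x. f x = poly_eval P x"
      using reduced_rep_exists[of f] by blast
    have "Q = P" if "reduced Q" "\<And>x. f x = poly_eval Q x" for Q
    proof (rule inj_onD[OF \<open>inj_on poly_eval ?R\<close>])
      show "poly_eval Q = poly_eval P"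
        using P(2) that(2) by auto
    qed (use P that in auto)
    with P show ?thesis
      by blast
  qed
  from theI'[OF this, folded reduced_rep_def]
  show "reduced (reduced_rep f)" "f x = poly_eval (reduced_rep f) x"
    by blast+
qed

text \<open>Every coordinate of the substituted point is affine in \<open>y\<close>, so a monomial
  of the reduced representation keeps its total degree as a bound. This links
  \<open>fun_degree\<close> to \<open>polyfun\<close>.\<close>

lemma polyfun_affine_substitution:
  fixes f :: "'a::{field,finite} ^ 'n::finite \<Rightarrow> 'a"
  shows "polyfun I (fun_degree f) (\<lambda>y. f (u + (\<Sum>v\<in>I. y v *s v)))"
proof -
  have coord: "polyfun I 1 (\<lambda>y. (u + (\<Sum>v\<in>I. y v *s v)) $ i)" for i
    using polyfun_add[OF polyfun_const[of I 1 "u $ i"]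
        polyfun_sum[of I I 1 "\<lambda>v y. (v $ i) * y v", OF polyfun_coord]]
    by (simp add: mult.commute)
  have "polyfun I (fun_degree f) (\<lambda>y. Poly_Mapping.lookup (reduced_rep f) m *
      (\<Prod>i\<in>UNIV. (u + (\<Sum>v\<in>I. y v *s v)) $ i ^ Poly_Mapping.lookup m i))"
    if "m \<in> Poly_Mapping.keys (reduced_rep f)" for m
  proof (rule polyfun_mono)
    show "polyfun I (0 + (\<Sum>i\<in>UNIV. 1 * Poly_Mapping.lookup m i))
        (\<lambda>y. Poly_Mapping.lookup (reduced_rep f) m *
          (\<Prod>i\<in>UNIV. (u + (\<Sum>v\<in>I. y v *s v)) $ i ^ Poly_Mapping.lookup m i))"
      by (intro polyfun_mult polyfun_const polyfun_prod polyfun_power coord)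
    show "0 + (\<Sum>i\<in>UNIV. 1 * Poly_Mapping.lookup m i) \<le> fun_degree f"
      using that by (auto simp: fun_degree_def intro!: Max_ge)
  qed
  then have "polyfun I (fun_degree f) (\<lambda>y. poly_eval (reduced_rep f) (u + (\<Sum>v\<in>I. y v *s v)))"
    unfolding poly_eval_def by (rule polyfun_sum)
  then show ?thesis
    by (simp only: reduced_rep(2)[symmetric])
qed

section \<open>The bound on the dimension\<close>

text \<open>The inner sum of \<open>subspace_dim\<close>. It counts the forms to be annihilated for
  one function of degree \<open>d\<close>: there are (k + j - 1) choose j monomials of degree j in k
  variables, each paired with the d - j exponents b \<ge> 1 such that j + b \<le> d.\<close>

definition dim_bound :: "nat \<Rightarrow> nat \<Rightarrow> nat"
  where "dim_bound k d = (\<Sum>j<d. (d - j) * ((k + j - 1) choose j))"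

lemma dim_bound_mono: "d \<le> e \<Longrightarrow> dim_bound k d \<le> dim_bound k e"
  unfolding dim_bound_def
  by (rule order.trans[OF sum_mono[of _ _ "\<lambda>j. (e - j) * ((k + j - 1) choose j)"] sum_mono2]) auto

lemma dim_bound_0: "dim_bound 0 d = d"
proof -
  have "dim_bound 0 d = (\<Sum>j<d. if j = 0 then d else 0)"
    unfolding dim_bound_def by (intro sum.cong) auto
  then show ?thesis
    by (cases d) auto
qed

text \<open>The factor d - j counts the i with j \<le> i < d, so the sum is a double sum over j
  \<le> i < d. The hockey-stick identity evaluates first the sum over j (\<open>row\<close>), then
  the one over i (\<open>diag\<close>).\<close>

lemma dim_bound_eq: "1 \<le> k \<Longrightarrow> 1 \<le> d \<Longrightarrow> dim_bound k d = (k + d) choose (d - 1)"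
proof -
  assume k: "1 \<le> k" and d: "1 \<le> d"
  have row: "(\<Sum>j\<le>i. (k + j - 1) choose j) = (k + i) choose i" for i
  proof -
    have "(\<Sum>j\<le>i. (k + j - 1) choose j) = (\<Sum>j\<le>i. (k - 1 + j) choose (k - 1))"
    proof (intro sum.cong refl)
      fix j
      show "(k + j - 1) choose j = (k - 1 + j) choose (k - 1)"
        using k binomial_symmetric[of j "k + j - 1"] by simp
    qed
    then show ?thesis
      using k choose_rising_sum(2)[where n = "k - 1" and m = i] by simp
  qed
  have diag: "(\<Sum>i\<le>e. (k + i) choose i) = (k + e + 1) choose e" for e
    using choose_rising_sum(2)[where n = k and m = e]
    by (simp add: binomial_symmetric[of k "k + _"])
  have "dim_bound k (Suc e) = (\<Sum>i\<le>e. \<Sum>j\<le>i. (k + j - 1) choose j)" for e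
  proof (induction e)
    case (Suc e)
    have "dim_bound k (Suc (Suc e)) =
        (\<Sum>j<Suc (Suc e). (Suc e - j) * ((k + j - 1) choose j) + ((k + j - 1) choose j))"
      unfolding dim_bound_def by (intro sum.cong) (auto simp: Suc_diff_le)
    also have "\<dots> = dim_bound k (Suc e) + (\<Sum>j\<le>Suc e. (k + j - 1) choose j)"
      by (simp add: sum.distrib dim_bound_def lessThan_Suc_atMost)
    finally show ?case
      using Suc by simp
  qed (simp add: dim_bound_def)
  from this[of "d - 1"] show ?thesis
    unfolding row diag using d by simp
qed

lemma subspace_dim_eq:
  "subspace_dim n t d = (LEAST k. n \<le> k + (\<Sum>i=1..t. (d i + 1) * dim_bound k (d i)))"
  by (simp add: subspace_dim_def dim_bound_def)

lemma subspace_dim_ge: "n \<le> subspace_dim n t d +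
    (\<Sum>i=1..t. (d i + 1) * dim_bound (subspace_dim n t d) (d i))"
  \<comment> \<open>The value \<open>n\<close> itself is admissible, so the minimum is
    attained.\<close>
  unfolding subspace_dim_eq by (rule LeastI[of _ n]) simp

lemma less_subspace_dimD:
  "k < subspace_dim n t d \<Longrightarrow> k + (\<Sum>i=1..t. (d i + 1) * dim_bound k (d i)) < n"
  unfolding subspace_dim_eq by (metis (lifting) not_less not_less_Least)

lemma subspace_dim_ratio_le:
  assumes "1 \<le> s" "\<forall>i\<in>{1..s}. e i \<le> D" "k = subspace_dim n s e"
  shows "real n / real s \<le> real k + (real D + 1) * real (dim_bound k D)"
proof -
  have "n \<le> k + (\<Sum>i=1..s. (e i + 1) * dim_bound k (e i))"
    using subspace_dim_ge assms(3) by simp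
  \<comment> \<open>Enlarging the single \<open>k\<close> to \<open>s * k\<close> makes the whole
    bound divisible by \<open>s\<close>.\<close>
  also have "\<dots> \<le> s * k + (\<Sum>i=1..s. (D + 1) * dim_bound k D)"
    using assms by (intro add_mono sum_mono mult_le_mono dim_bound_mono) auto
  also have "\<dots> = s * (k + (D + 1) * dim_bound k D)"
    by (simp add: algebra_simps)
  finally have "real n \<le> real (s * (k + (D + 1) * dim_bound k D))"
    by (rule of_nat_mono)
  then show ?thesis
    using assms(1) by (simp add: field_simps)
qed

section \<open>Estimates for roots, factorials and binomial coefficients\<close>

lemma powr_inverse_le:
  fixes x b :: real
  assumes "2 \<le> D" "0 \<le> x" "0 \<le> b" "x \<le> b ^ (D - 1)"
  shows "x powr (1 / (real D - 1)) \<le> b"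
proof -
  have "x powr (1 / (real D - 1)) \<le> (b ^ (D - 1)) powr (1 / (real D - 1))"
    using assms by (intro powr_mono2) auto
  also have "\<dots> = b"
  proof (cases "b = 0")
    case False
    then have "b ^ (D - 1) = b powr (real D - 1)"
      using assms by (simp add: powr_realpow[symmetric] of_nat_diff)
    then show ?thesis
      using assms False by (simp add: powr_powr)
  qed (use assms in auto)
  finally show ?thesis .
qed

text \<open>Lets the factor D + 1 be absorbed into the base of a (D - 1)-th power.\<close>

lemma Suc_le_power_3:
  assumes "2 \<le> D"
  shows "real D + 1 \<le> 3 ^ (D - 1)"
proof -
  have "1 \<le> r \<Longrightarrow> real r + 2 \<le> 3 ^ r" for r
    by (induction r rule: dec_induct) auto
  moreover have "1 \<le> D - 1" "real D + 1 = real (D - 1) + 2"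
    using assms by (auto simp: of_nat_diff)
  ultimately show ?thesis
    by metis
qed

lemma binomial_le_power_div_fact: "real (n choose r) \<le> real n ^ r / fact r"
  using binomial_fact_pow[of n r] of_nat_mono[of "(n choose r) * fact r" "n ^ r", where 'a = real]
  by (simp add: field_simps)

text \<open>The quotient n^n / n! is a single term of the exponential series at n.\<close>

lemma power_le_exp_fact: "real n ^ n \<le> exp (real n) * fact n"
proof -
  have "(\<lambda>i. real n ^ i / fact i) sums exp (real n)"
    using exp_converges[of "real n"] by (simp add: divide_real_def mult.commute)
  from sum_le_suminf[OF sums_summable[OF this], of "{n}"] sums_unique[OF this]
  have "real n ^ n / fact n \<le> exp (real n)"
    by simp
  then show ?thesis
    by (simp add: field_simps)
qed

text \<open>Passing from r to r + 1 multiplies the binomial by (k + r + 2) / (r + 1), which is at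
  most k + 2.\<close>

lemma binomial_Suc_le_power: "real ((k + r + 1) choose r) \<le> (real k + 2) ^ r"
proof (induction r)
  case (Suc r)
  have Suc_eq: "k + Suc r + 1 = Suc (k + r + 1)"
    by simp
  have "real (Suc r) * real (Suc (k + r + 1) choose Suc r)
      = real (Suc (k + r + 1)) * real ((k + r + 1) choose r)"
    using Suc_times_binomial_eq[of "k + r + 1" r] by (metis mult.commute of_nat_mult)
  also have "\<dots> \<le> (real (Suc r) * (real k + 2)) * (real k + 2) ^ r"
    by (rule mult_mono[OF _ Suc]) (simp_all add: algebra_simps)
  finally have "real (Suc r) * real (Suc (k + r + 1) choose Suc r)
      \<le> real (Suc r) * ((real k + 2) ^ Suc r)"
    by (simp only: power_Suc mult_ac)
  then show ?case
    unfolding Suc_eq by (subst (asm) mult_le_cancel_left_pos) simp_all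
qed simp

lemma power_add_power_le:
  fixes a b :: real
  assumes "0 \<le> a" "0 \<le> b" "1 \<le> r"
  shows "a ^ r + b ^ r \<le> (a + b) ^ r"
  using assms(3)
proof (induction r rule: dec_induct)
  case (step r)
  have "a ^ Suc r + b ^ Suc r \<le> (a + b) * (a ^ r + b ^ r)"
    using assms by (simp add: algebra_simps)
  also have "\<dots> \<le> (a + b) * (a + b) ^ r"
    using step assms by (intro mult_left_mono) auto
  finally show ?case
    by simp
qed simp

lemma subspace_dim_ge_root:
  assumes "1 \<le> s" "2 \<le> D" "\<forall>i\<in>{1..s}. e i \<le> D"
    and "7 \<le> (real n / real s) powr (1 / (real D - 1))"
  shows "1 \<le> subspace_dim n s e"
    and "(real n / real s) powr (1 / (real D - 1)) \<le> 10 * real (subspace_dim n s e)"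
proof -
  define k where "k = subspace_dim n s e"
  have le: "real n / real s \<le> real k + (real D + 1) * real (dim_bound k D)"
    using assms k_def by (intro subspace_dim_ratio_le) auto
  \<comment> \<open>For k = 0 the bound reads n / s \<le> D (D + 1) \<le> 6^(D-1), so the root would
    be at most 6; this explains the threshold 7.\<close>
  have k: "1 \<le> k"
  proof (rule ccontr)
    assume "\<not> 1 \<le> k"
    then have "k = 0"
      by simp
    then have "real n / real s \<le> (real D + 1) * real D"
      using le by (simp add: dim_bound_0)
    also have "\<dots> \<le> 3 ^ (D - 1) * 2 ^ (D - 1)"
    proof (intro mult_mono)
      show "real D \<le> 2 ^ (D - 1)"
        using assms(2) of_nat_mono[OF Suc_leI[OF less_exp[of "D - 1"]], where 'a = real] by simp
    qed (use Suc_le_power_3 assms in auto)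
    also have "\<dots> = 6 ^ (D - 1)"
      by (simp only: power_mult_distrib[symmetric]) simp
    finally show False
      using powr_inverse_le[of D "real n / real s" 6] assms by simp
  qed
  then show "1 \<le> subspace_dim n s e"
    by (simp add: k_def)
  have "dim_bound k D = (k + D) choose (D - 1)"
    using k assms by (intro dim_bound_eq) auto
  then have "real (dim_bound k D) \<le> (real k + 2) ^ (D - 1)"
    using binomial_Suc_le_power[of k "D - 1"] assms(2) by simp
  also have "\<dots> \<le> (3 * real k) ^ (D - 1)"
    using k by (intro power_mono) auto
  finally have dim: "real (dim_bound k D) \<le> (3 * real k) ^ (D - 1)" .
  \<comment> \<open>The two factors 3 give the base 9 k; the remaining summand k raises it to 10
    k.\<close>
  have "(real D + 1) * real (dim_bound k D) \<le> 3 ^ (D - 1) * (3 * real k) ^ (D - 1)"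
    using Suc_le_power_3[OF assms(2)] dim by (rule mult_mono) simp_all
  also have "\<dots> = (9 * real k) ^ (D - 1)"
    by (simp only: power_mult_distrib[symmetric]) simp
  finally have "real n / real s \<le> real k ^ 1 + (9 * real k) ^ (D - 1)"
    using le by simp
  also have "\<dots> \<le> real k ^ (D - 1) + (9 * real k) ^ (D - 1)"
    using k assms by (intro add_mono power_increasing) auto
  also have "\<dots> \<le> (real k + 9 * real k) ^ (D - 1)"
    using assms(2) by (intro power_add_power_le) auto
  finally show "(real n / real s) powr (1 / (real D - 1)) \<le> 10 * real (subspace_dim n s e)"
    using powr_inverse_le[of D "real n / real s" "10 * k"] assms by (simp add: k_def)
qed

text \<open>The hypothesis says n / s \<ge> 2^(10 D), which forces k \<ge> D. With r = D - 1 the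
  binomial is then at most (2 k)^r / r!, and the factorial supplies the additional factor of order D
  after taking roots.\<close>

lemma subspace_dim_ge_degree_times_root:
  assumes "1 \<le> s" "2 \<le> D" "\<forall>i\<in>{1..s}. e i \<le> D"
    and log: "real D \<le> log 2 (real n / real s) / 10"
  shows "real D * (real n / real s) powr (1 / (real D - 1)) \<le> 72 * real (subspace_dim n s e)"
proof -
  define k where "k = subspace_dim n s e"
  define N where "N = real n / real s"
  have "n \<noteq> 0"
  proof
    assume "n = 0"
    \<comment> \<open>By convention the logarithm of 0 is 0.\<close>
    then have "real D \<le> 0" using log by (simp add: log_def)
    then show False using assms(2) by simp
  qed
  then have N0: "N > 0"
    using assms(1) by (simp add: N_def)
  have "2 powr (10 * real D) \<le> N"
    using log N0 by (simp add: le_log_iff N_def mult.commute)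
  moreover have "(2 :: real) ^ (10 * D) = 2 powr (10 * real D)"
    by (subst powr_realpow[symmetric]) auto
  ultimately have N: "2 ^ (10 * D) \<le> N"
    by (simp only:)
  have le: "N \<le> real k + (real D + 1) * real (dim_bound k D)"
    unfolding N_def using assms k_def by (intro subspace_dim_ratio_le) auto
  have "7 \<le> N powr (1 / (real D - 1))"
  proof (rule ccontr)
    assume "\<not> ?thesis"
    then have "(N powr (1 / (real D - 1))) ^ (D - 1) < 7 ^ (D - 1)"
      using assms(2) by (intro power_strict_mono) auto
    moreover have "(N powr (1 / (real D - 1))) ^ (D - 1) = N"
    proof -
      have "(N powr (1 / (real D - 1))) ^ (D - 1) = (N powr (1 / (real D - 1))) powr real (D - 1)"
        using N0 by (intro powr_realpow[symmetric]) simp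
      also have "\<dots> = N"
        using assms(2) N0 by (simp add: powr_powr of_nat_diff)
      finally show ?thesis .
    qed
    moreover have "(7 :: real) ^ (D - 1) \<le> 8 ^ D"
      by (rule order.trans[OF power_mono power_increasing]) auto
    moreover have "(8 :: real) ^ D \<le> 2 ^ (10 * D)"
      by (simp add: power_mult power_mono)
    ultimately show False
      using N by linarith
  qed
  then have k: "1 \<le> k"
    using subspace_dim_ge_root(1)[of s D e n] assms by (simp add: k_def N_def)
  have dim: "dim_bound k D = (k + D) choose (D - 1)"
    using k assms by (intro dim_bound_eq) auto
  \<comment> \<open>If k < D, the binomial is at most 4^D, and the right side of \<open>le\<close>
    is at most (2 D + 1) 4^D < 16^D, contradicting n / s \<ge> 2^(10 D).\<close>
  have kD: "D \<le> k"
  proof (rule ccontr)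
    assume kD: "\<not> D \<le> k"
    have "real (dim_bound k D) \<le> 2 ^ (k + D)"
      using of_nat_mono[OF binomial_le_pow2[of "k + D" "D - 1"], where 'a = real] dim by simp
    also have "\<dots> \<le> 2 ^ (2 * D)"
      using kD by (intro power_increasing) auto
    finally have "real k + (real D + 1) * real (dim_bound k D) \<le> real D * 2 ^ (2 * D) + (real D + 1) * 2 ^ (2 * D)"
    proof (intro add_mono mult_left_mono)
      have "real k * 1 \<le> real D * 2 ^ (2 * D)"
        using kD by (intro mult_mono) auto
      then show "real k \<le> real D * 2 ^ (2 * D)"
        by simp
    qed auto
    also have "\<dots> = (2 * real D + 1) * 2 ^ (2 * D)"
      by (simp add: algebra_simps)
    also have "\<dots> < 2 ^ (2 * D) * 2 ^ (2 * D)"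
    proof -
      have "2 \<le> m \<Longrightarrow> m + 1 < 2 ^ m" for m :: nat
        by (induction m rule: dec_induct) auto
      then have "2 * D + 1 < 2 ^ (2 * D)"
        using assms(2) by simp
      then have "real (2 * D + 1) < real (2 ^ (2 * D))"
        by (simp only: of_nat_less_iff)
      then show ?thesis
        by (intro mult_strict_right_mono) auto
    qed
    also have "\<dots> \<le> 2 ^ (10 * D)"
      unfolding power_add[symmetric] by (rule power_increasing) auto
    finally show False
      using N le by linarith
  qed
  define r where "r = D - 1"
  have r: "1 \<le> r" "D = Suc r"
    using assms by (auto simp: r_def)
  have "real (dim_bound k D) \<le> real (k + D) ^ r / fact r"
    unfolding dim r_def by (rule binomial_le_power_div_fact)
  also have "\<dots> \<le> (2 * real k) ^ r / fact r"
    using kD by (intro divide_right_mono power_mono) auto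
  also have "\<dots> \<le> (2 * real k) ^ r * (exp 1 / real r) ^ r"
  proof -
    have "1 / fact r \<le> (exp 1 / real r) ^ r"
      using power_le_exp_fact[of r] r exp_of_nat_mult[of r "1 :: real"]
      by (simp add: power_divide divide_le_eq pos_le_divide_eq mult.commute)
    then show ?thesis
      using mult_left_mono[of "1 / fact r" _ "(2 * real k) ^ r"] by simp
  qed
  also have "\<dots> = (2 * real k * exp 1 / real r) ^ r"
    by (simp only: power_mult_distrib[symmetric] times_divide_eq_right)
  also have "\<dots> \<le> (2 * real k * 3 / real r) ^ r"
    using exp_le by (intro power_mono divide_right_mono mult_left_mono) auto
  finally have b: "real (dim_bound k D) \<le> (6 * real k / real r) ^ r"
    by (simp add: mult.commute)
  \<comment> \<open>The additive k is dominated by the main term, via (m / r)^r \<le> m choose r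
    with m = k + D, so it costs only a factor 2.\<close>
  have "real k \<le> (real D + 1) * real (dim_bound k D)"
  proof -
    have "real k \<le> real D * (real (k + D) / real r)"
    proof -
      have "real k * real r \<le> real D * real (k + D)"
        using r mult_mono[of "real k" "real (k + D)" "real r" "real D"] by (simp add: mult.commute)
      then show ?thesis
        using r by (simp add: pos_le_divide_eq)
    qed
    also have "real (k + D) / real r \<le> (real (k + D) / real r) ^ r"
      using r power_increasing[of 1 r "real (k + D) / real r"] by simp
    also have "\<dots> \<le> real (dim_bound k D)"
      using binomial_ge_n_over_k_pow_k[of r "k + D", where 'a = real] r dim by simp
    finally show ?thesis
      using assms(2) by (simp add: distrib_right mult_left_mono)
  qed
  with le have "N \<le> (real D + 1) * (2 * real (dim_bound k D))"
    by (simp add: algebra_simps)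
  \<comment> \<open>All factors become r-th powers, with bases multiplying to 36 k / r; replacing r
    by D below doubles 36 to 72, since D \<le> 2 r.\<close>
  also have "\<dots> \<le> 3 ^ r * (2 ^ r * (6 * real k / real r) ^ r)"
  proof (intro mult_mono)
    show "real D + 1 \<le> 3 ^ r"
      using Suc_le_power_3 assms(2) r_def by blast
    show "2 \<le> (2 :: real) ^ r"
      using power_increasing[of 1 r "2 :: real"] r by simp
  qed (use b in auto)
  also have "\<dots> = (36 * real k / real r) ^ r"
    by (simp only: power_mult_distrib[symmetric]) simp
  finally have "N powr (1 / (real D - 1)) \<le> 36 * real k / real r"
    using powr_inverse_le[of D N "36 * real k / real r"] assms(2) N0 by (simp add: r_def)
  then have "real r * N powr (1 / (real D - 1)) \<le> 36 * real k"
    using r by (simp add: field_simps)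
  moreover have "real D * N powr (1 / (real D - 1)) \<le> (2 * real r) * N powr (1 / (real D - 1))"
    using r by (intro mult_right_mono) auto
  ultimately show ?thesis
    by (simp add: N_def k_def)
qed

section \<open>Extending the subspace\<close>

text \<open>Each monomial splits into its part \<open>m\<close> over \<open>B\<close> and its part
  over \<open>W\<close>; when the latter has size b, scaling \<open>c\<close> by \<open>a\<close>
  extracts a^b. Thus \<open>G m b\<close> collects the coefficient of y^m a^b, a form of degree b in
  \<open>c\<close>.\<close>

lemma polyfun_decomposition:
  fixes F :: "('i \<Rightarrow> 'a::field) \<Rightarrow> 'a"
  assumes F: "polyfun (B \<union> W) d F" and fin: "finite B" "finite W" and disj: "B \<inter> W = {}"
  obtains G where "\<And>m b. polyfun W b (G m b)"
    and "\<And>m b. 0 < b \<Longrightarrow> G m b (\<lambda>i\<in>W. 0) = 0"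
    and "\<And>y a c. F (\<lambda>i. if i \<in> B then y i else a * c i) =
      (\<Sum>m\<in>multisets_upto B d. monomial m y * (\<Sum>b\<le>d - size m. a ^ b * G m b c))"
proof -
  obtain g where g: "\<And>y. F y = (\<Sum>m\<in>multisets_upto (B \<union> W) d. g m * monomial m y)"
    using polyfun_coeffs[OF F] fin by blast
  define G where "G m b c = (\<Sum>m'\<in>multisets_of_size W b. g (m + m') * monomial m' c)" for m b c
  have "polyfun W b (G m b)" for m b
    unfolding G_def
    by (intro polyfun_sum polyfun_monomial) (auto simp: multisets_of_size_def)
  \<comment> \<open>The origin is written as in \<open>chevalley\<close>, unspecified off
    \<open>W\<close>; only indices in \<open>W\<close> occur, and b > 0 leaves at least one zero
    factor.\<close>
  moreover have "G m b (\<lambda>i\<in>W. 0) = 0" if "0 < b" for m b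
  proof -
    have "monomial m' (\<lambda>i\<in>W. 0) = (0 :: 'a)" if m': "m' \<in> multisets_of_size W b" for m'
    proof -
      obtain i m'' where "m' = add_mset i m''"
        using m' \<open>0 < b\<close> by (cases m') (auto simp: multisets_of_size_def)
      then show ?thesis
        using m' by (simp add: multisets_of_size_def)
    qed
    then show ?thesis
      by (simp add: G_def)
  qed
  moreover have "F (\<lambda>i. if i \<in> B then y i else a * c i) =
      (\<Sum>m\<in>multisets_upto B d. monomial m y * (\<Sum>b\<le>d - size m. a ^ b * G m b c))" for y a c
  proof -
    let ?z = "\<lambda>i. if i \<in> B then y i else a * c i"
    let ?S = "SIGMA m:multisets_upto B d. multisets_upto W (d - size m)"
    have "F ?z = (\<Sum>(m, m')\<in>?S. g (m + m') * monomial (m + m') ?z)"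
      unfolding g
    proof (rule sum.reindex_bij_witness[of _ "\<lambda>(m, m'). m + m'"
          "\<lambda>M. (filter_mset (\<lambda>i. i \<in> B) M, filter_mset (\<lambda>i. i \<notin> B) M)"])
      fix p
      assume "p \<in> ?S"
      then obtain m m' where p: "p = (m, m')" "set_mset m \<subseteq> B" "set_mset m' \<subseteq> W"
        "size m + size m' \<le> d"
        by (auto simp: multisets_upto_def)
      have "filter_mset (\<lambda>i. i \<in> B) m = m" "filter_mset (\<lambda>i. i \<notin> B) m = {#}"
        "filter_mset (\<lambda>i. i \<in> B) m' = {#}" "filter_mset (\<lambda>i. i \<notin> B) m' = m'"
        using p disj by (auto simp: filter_mset_eq_conv)
      then show "(filter_mset (\<lambda>i. i \<in> B) (case p of (m, m') \<Rightarrow> m + m'),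
          filter_mset (\<lambda>i. i \<notin> B) (case p of (m, m') \<Rightarrow> m + m')) = p"
        using p by simp
      show "(case p of (m, m') \<Rightarrow> m + m') \<in> multisets_upto (B \<union> W) d"
        using p by (auto simp: multisets_upto_def)
    next
      fix M
      assume M: "M \<in> multisets_upto (B \<union> W) d"
      have "size (filter_mset (\<lambda>i. i \<in> B) M) + size (filter_mset (\<lambda>i. i \<notin> B) M) = size M"
        by (metis multiset_partition size_union)
      then show "(filter_mset (\<lambda>i. i \<in> B) M, filter_mset (\<lambda>i. i \<notin> B) M) \<in> ?S"
        using M by (auto simp: multisets_upto_def)
    qed (simp_all only: prod.case multiset_partition[symmetric])
    also have "\<dots> = (\<Sum>m\<in>multisets_upto B d. \<Sum>m'\<in>multisets_upto W (d - size m).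
        g (m + m') * monomial (m + m') ?z)"
      using fin by (intro sum.Sigma[symmetric]) (auto intro: finite_multisets_upto)
    also have "\<dots> = (\<Sum>m\<in>multisets_upto B d.
        monomial m y * (\<Sum>b\<le>d - size m. a ^ b * G m b c))"
    proof (rule sum.cong[OF refl])
      fix m
      assume "m \<in> multisets_upto B d"
      then have my: "monomial m ?z = monomial m y"
        by (intro monomial_cong) (auto simp: multisets_upto_def)
      have "(\<Sum>m'\<in>multisets_upto W (d - size m). g (m + m') * monomial (m + m') ?z)
          = (\<Sum>b\<le>d - size m. \<Sum>m'\<in>multisets_of_size W b. g (m + m') * monomial (m + m') ?z)"
        unfolding multisets_upto_eq_UN using fin
        by (intro sum.UNION_disjoint)
          (blast, blast intro: finite_multisets_of_size, auto simp: multisets_of_size_def)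
      also have "\<dots> = (\<Sum>b\<le>d - size m. \<Sum>m'\<in>multisets_of_size W b.
          monomial m y * (a ^ b * (g (m + m') * monomial m' c)))"
      proof (intro sum.cong refl)
        fix b m'
        assume m': "m' \<in> multisets_of_size W b"
        then have "monomial m' ?z = monomial m' (\<lambda>i. a * c i)"
          using disj by (intro monomial_cong) (auto simp: multisets_of_size_def)
        then show "g (m + m') * monomial (m + m') ?z
            = monomial m y * (a ^ b * (g (m + m') * monomial m' c))"
          using m' by (simp add: my monomial_scale multisets_of_size_def)
      qed
      finally show "(\<Sum>m'\<in>multisets_upto W (d - size m). g (m + m') * monomial (m + m') ?z)
          = monomial m y * (\<Sum>b\<le>d - size m. a ^ b * G m b c)"
        by (simp add: G_def sum_distrib_left)
    qed
    finally show ?thesis .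
  qed
  ultimately show ?thesis
    by (rule that)
qed

text \<open>For fixed \<open>m\<close> there are d - size m forms, each of degree at most d + 1;
  grouping the \<open>m\<close> by size yields \<open>dim_bound\<close>.\<close>

lemma sum_coefficient_degrees_le:
  assumes "finite B"
  shows "(\<Sum>m\<in>multisets_upto B d. \<Sum>b=1..d - size m. b) \<le> (d + 1) * dim_bound (card B) d"
proof -
  have "(\<Sum>b=1..d - size m. b) \<le> (d + 1) * (d - size m)" for m :: "'b multiset"
  proof -
    have "(\<Sum>b=1..d - size m. b) \<le> of_nat (card {1..d - size m}) * (d + 1)"
      by (rule sum_bounded_above) auto
    then show ?thesis
      by (simp add: mult.commute)
  qed
  then have "(\<Sum>m\<in>multisets_upto B d. \<Sum>b=1..d - size m. b)
      \<le> (\<Sum>m\<in>multisets_upto B d. (d + 1) * (d - size m))"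
    by (intro sum_mono)
  also have "\<dots> = (d + 1) * (\<Sum>j\<le>d. ((card B + j - 1) choose j) * (d - j))"
    using sum_multisets_upto_size[OF assms, of "\<lambda>j. d - j" d]
    by (simp only: sum_distrib_left[symmetric])
  \<comment> \<open>The term j = d is zero, which accounts for the shorter range in
    \<open>dim_bound\<close>.\<close>
  also have "(\<Sum>j\<le>d. ((card B + j - 1) choose j) * (d - j)) = dim_bound (card B) d"
    unfolding dim_bound_def lessThan_Suc_atMost[symmetric] by (simp add: mult.commute)
  finally show ?thesis .
qed

lemma extend_constancy_subspace:
  fixes f :: "'i \<Rightarrow> 'a::{field,finite} ^ 'n::finite \<Rightarrow> 'a"
  assumes B: "vec.independent B" and T: "finite T"
    and const: "\<And>i x. i \<in> T \<Longrightarrow> x \<in> vec.span B \<Longrightarrow> f i (u + x) = f i u"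
    and dim: "card B + (\<Sum>i\<in>T. (fun_degree (f i) + 1) * dim_bound (card B) (fun_degree (f i)))
      < CARD('n)"
  obtains x where "x \<notin> vec.span B"
    and "\<And>i z. i \<in> T \<Longrightarrow> z \<in> vec.span (insert x B) \<Longrightarrow> f i (u + z) = f i u"
proof -
  obtain B' where B': "B \<subseteq> B'" "vec.independent B'" "UNIV \<subseteq> vec.span B'"
    by (rule vec.maximal_independent_subset_extend[OF subset_UNIV B])
  define W where "W = B' - B"
  have fin: "finite B" "finite W"
    by simp_all
  have disj: "B \<inter> W = {}" and BW: "B \<union> W = B'"
    using B' by (auto simp: W_def)
  have "card B' = CARD('n)"
    using vec.dim_eq_card[of B' UNIV] B' by (simp add: card_cart_basis top.extremum_unique)
  then have cardW: "card W = CARD('n) - card B"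
    using B' by (simp add: W_def card_Diff_subset)
  define F where "F i y = f i (u + (\<Sum>v\<in>B \<union> W. y v *s v))" for i y
  have "\<exists>G. (\<forall>m b. polyfun W b (G m b)) \<and> (\<forall>m b. 0 < b \<longrightarrow> G m b (\<lambda>i\<in>W. 0) = 0) \<and>
    (\<forall>y a c. F i (\<lambda>v. if v \<in> B then y v else a * c v) =
      (\<Sum>m\<in>multisets_upto B (fun_degree (f i)).
        monomial m y * (\<Sum>b\<le>fun_degree (f i) - size m. a ^ b * G m b c)))" (is "\<exists>G. ?P i G") for i
  proof -
    have "polyfun (B \<union> W) (fun_degree (f i)) (F i)"
      unfolding F_def by (rule polyfun_affine_substitution)
    then show ?thesis
      by (rule polyfun_decomposition[OF _ fin disj]) (intro exI conjI allI impI)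
  qed
  then have "\<exists>G. \<forall>i. ?P i (G i)"
    by (intro choice allI)
  then obtain G where "\<forall>i. ?P i (G i)" ..
  then have G: "\<And>i m b. polyfun W b (G i m b)"
    "\<And>i m b. 0 < b \<Longrightarrow> G i m b (\<lambda>i\<in>W. 0) = 0"
    "\<And>i y a c. F i (\<lambda>v. if v \<in> B then y v else a * c v) =
      (\<Sum>m\<in>multisets_upto B (fun_degree (f i)).
        monomial m y * (\<Sum>b\<le>fun_degree (f i) - size m. a ^ b * G i m b c))"
    by blast+
  \<comment> \<open>\<open>J\<close> indexes the forms \<open>G i m b\<close> with b \<ge> 1, whose
    degree is the last component b. The forms with b = 0 are left out, being constant along the new
    direction.\<close>
  define J where "J = (SIGMA i:T. SIGMA m:multisets_upto B (fun_degree (f i)).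
    {1..fun_degree (f i) - size m})"
  have "finite J"
    using T fin by (auto simp: J_def intro!: finite_SigmaI finite_multisets_upto)
  have "(\<Sum>j\<in>J. snd (snd j)) = (\<Sum>i\<in>T. \<Sum>m\<in>multisets_upto B (fun_degree (f i)).
      \<Sum>b=1..fun_degree (f i) - size m. b)"
    using T fin
    by (simp add: J_def sum.Sigma finite_multisets_upto case_prod_beta)
  also have "\<dots> \<le> (\<Sum>i\<in>T. (fun_degree (f i) + 1) * dim_bound (card B) (fun_degree (f i)))"
    using fin by (intro sum_mono sum_coefficient_degrees_le)
  also have "\<dots> < card W"
    using dim cardW by simp
  finally have lt: "(\<Sum>j\<in>J. snd (snd j)) < card W" .
  obtain c w where w: "w \<in> W" "c w \<noteq> 0"
    and c: "\<And>j. j \<in> J \<Longrightarrow> (case j of (i, m, b) \<Rightarrow> G i m b) c = 0"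
    by (rule chevalley[OF fin(2) \<open>finite J\<close> _ lt, where g = "\<lambda>(i, m, b). G i m b"])
      (auto simp: G J_def)
  define x where "x = (\<Sum>v\<in>W. c v *s v)"
  \<comment> \<open>Otherwise, as c w is nonzero, solving for \<open>w\<close> would express it
    through the other vectors of the basis \<open>B'\<close>.\<close>
  have "x \<notin> vec.span B"
  proof
    assume "x \<in> vec.span B"
    then have "x \<in> vec.span (B' - {w})"
      using vec.span_mono[of B "B' - {w}"] B' w by (auto simp: W_def)
    moreover have "(\<Sum>v\<in>W - {w}. c v *s v) \<in> vec.span (B' - {w})"
      by (intro vec.span_sum vec.span_scale vec.span_base) (auto simp: W_def)
    ultimately have "x - (\<Sum>v\<in>W - {w}. c v *s v) \<in> vec.span (B' - {w})"
      by (rule vec.span_diff)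
    also have "x - (\<Sum>v\<in>W - {w}. c v *s v) = c w *s w"
      unfolding x_def using sum.remove[OF fin(2) w(1), of "\<lambda>v. c v *s v"] by simp
    finally have "inverse (c w) *s (c w *s w) \<in> vec.span (B' - {w})"
      by (rule vec.span_scale)
    then have "w \<in> vec.span (B' - {w})"
      using w by simp
    then show False
      using B'(2) w vec.dependent_def by (auto simp: W_def)
  qed
  moreover have "f i (u + z) = f i u" if i: "i \<in> T" and z: "z \<in> vec.span (insert x B)" for i z
  proof -
    obtain a where "z - a *s x \<in> vec.span B"
      using z vec.span_breakdown_eq by blast
    then obtain y where y: "z - a *s x = (\<Sum>v\<in>B. y v *s v)"
      using vec.span_finite[OF fin(1)] by auto
    have F: "F i (\<lambda>v. if v \<in> B then y v else a' * c v) = f i (u + ((\<Sum>v\<in>B. y v *s v) + a' *s x))"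
      for a'
    proof -
      have "(\<Sum>v\<in>B \<union> W. (if v \<in> B then y v else a' * c v) *s v)
          = (\<Sum>v\<in>B. y v *s v) + (\<Sum>v\<in>W. (a' * c v) *s v)"
        using disj by (subst sum.union_disjoint[OF fin disj]) (auto intro!: sum.cong arg_cong2[of _ _ _ _ "(+)"])
      also have "(\<Sum>v\<in>W. (a' * c v) *s v) = a' *s x"
        by (simp add: x_def vec.scale_sum_right)
      finally show ?thesis
        by (simp add: F_def)
    qed
    \<comment> \<open>All terms with a positive power of a' vanish by the choice of
      \<open>c\<close>, so the value does not depend on a'. Replacing a by 0 then moves the point
      back into the span of \<open>B\<close>.\<close>
    have indep: "F i (\<lambda>v. if v \<in> B then y v else a' * c v) =
        (\<Sum>m\<in>multisets_upto B (fun_degree (f i)). monomial m y * G i m 0 c)" for a'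
      unfolding G(3)
    proof (intro sum.cong refl arg_cong2[of _ _ _ _ "(*)"])
      fix m
      assume m: "m \<in> multisets_upto B (fun_degree (f i))"
      have "(\<Sum>b\<le>fun_degree (f i) - size m. a' ^ b * G i m b c) = (\<Sum>b\<in>{0}. a' ^ b * G i m b c)"
      proof (intro sum.mono_neutral_right ballI)
        fix b
        assume "b \<in> {..fun_degree (f i) - size m} - {0}"
        then have "(i, m, b) \<in> J"
          using i m by (auto simp: J_def)
        from c[OF this] show "a' ^ b * G i m b c = 0"
          by simp
      qed auto
      then show "(\<Sum>b\<le>fun_degree (f i) - size m. a' ^ b * G i m b c) = G i m 0 c"
        by simp
    qed
    have "u + z = u + ((\<Sum>v\<in>B. y v *s v) + a *s x)"
      using y by (simp add: diff_eq_eq)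
    then have "f i (u + z) = f i (u + ((\<Sum>v\<in>B. y v *s v) + 0 *s x))"
      using F[of a] F[of 0] indep[of a] indep[of 0] by simp
    also have "\<dots> = f i u"
      using const[OF i, of "\<Sum>v\<in>B. y v *s v"]
      by (simp add: vec.span_sum vec.span_scale vec.span_base)
    finally show ?thesis .
  qed
  ultimately show ?thesis
    by (rule that)
qed

text \<open>Every k below \<open>subspace_dim\<close> violates the inequality defining that minimum,
  and the violation is exactly the strict inequality required by
  \<open>extend_constancy_subspace\<close>. Hence the induction can run up to the minimum
  itself.\<close>

lemma constancy_subspace_exists:
  fixes f :: "nat \<Rightarrow> 'a::{field,finite} ^ 'n::finite \<Rightarrow> 'a"
  assumes d: "\<And>i. i \<in> {1..t} \<Longrightarrow> fun_degree (f i) = d i"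
    and "k \<le> subspace_dim CARD('n) t d"
  shows "\<exists>B. vec.independent B \<and> card B = k \<and>
    (\<forall>i\<in>{1..t}. \<forall>x\<in>vec.span B. f i (u + x) = f i u)"
  using assms(2)
proof (induction k)
  case 0
  show ?case
    by (intro exI[of _ "{}"]) (simp add: vec.independent_empty)
next
  case (Suc k)
  then obtain B where B: "vec.independent B" "card B = k"
    "\<And>i x. i \<in> {1..t} \<Longrightarrow> x \<in> vec.span B \<Longrightarrow> f i (u + x) = f i u"
    by auto
  have "card B + (\<Sum>i\<in>{1..t}. (fun_degree (f i) + 1) * dim_bound (card B) (fun_degree (f i)))
      < CARD('n)"
    using less_subspace_dimD[of k "CARD('n)" t d] Suc.prems d B(2) by simp
  then obtain x where x: "x \<notin> vec.span B"
    "\<And>i z. i \<in> {1..t} \<Longrightarrow> z \<in> vec.span (insert x B) \<Longrightarrow> f i (u + z) = f i u"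
    using extend_constancy_subspace[of B "{1..t}" f u] B by blast
  then have "vec.independent (insert x B)"
    using B vec.independent_insertI by blast
  moreover have "card (insert x B) = Suc k"
    using x(1) B(2) vec.span_base[of x B] by (subst card_insert_disjoint) auto
  ultimately show ?case
    using x(2) by blast
qed

theorem theorem3p5:
  fixes f :: "nat \<Rightarrow> 'a::{field,finite} ^ 'n::finite \<Rightarrow> 'a"
    and t :: nat and d :: "nat \<Rightarrow> nat"
  assumes "\<forall>i\<in>{1..t}. fun_degree (f i) = d i"
  shows "(\<forall>u\<^sub>0. \<exists>U. vec.subspace U \<and> vec.dim U = subspace_dim CARD('n) t d \<and>
            (\<forall>i\<in>{1..t}. f i constant_on ((+) u\<^sub>0 ` U)))
    \<and> (\<exists>c>0::real. \<exists>C::real. \<forall>(n::nat) (s::nat) (e::nat \<Rightarrow> nat) (D::nat).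
            1 \<le> s \<longrightarrow> 2 \<le> D \<longrightarrow> (\<forall>i\<in>{1..s}. e i \<le> D) \<longrightarrow>
            C \<le> (real n / real s) powr (1 / (real D - 1)) \<longrightarrow>
            c * (real n / real s) powr (1 / (real D - 1)) \<le> real (subspace_dim n s e))
    \<and> (\<exists>c>0::real. \<forall>(n::nat) (s::nat) (e::nat \<Rightarrow> nat) (D::nat).
            1 \<le> s \<longrightarrow> 2 \<le> D \<longrightarrow> (\<forall>i\<in>{1..s}. e i \<le> D) \<longrightarrow>
            real D \<le> log 2 (real n / real s) / 10 \<longrightarrow>
            c * (real D * (real n / real s) powr (1 / (real D - 1))) \<le> real (subspace_dim n s e))"
proof (intro conjI allI)
  fix u\<^sub>0 :: "'a ^ 'n"
  obtain B where B: "vec.independent B" "card B = subspace_dim CARD('n) t d"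
    "\<And>i x. i \<in> {1..t} \<Longrightarrow> x \<in> vec.span B \<Longrightarrow> f i (u\<^sub>0 + x) = f i u\<^sub>0"
    using constancy_subspace_exists[of t f d _ u\<^sub>0] assms by blast
  then show "\<exists>U. vec.subspace U \<and> vec.dim U = subspace_dim CARD('n) t d \<and>
      (\<forall>i\<in>{1..t}. f i constant_on ((+) u\<^sub>0 ` U))"
    by (intro exI[of _ "vec.span B"])
      (auto simp: constant_on_def vec.dim_eq_card_independent intro!: exI[of _ "f _ u\<^sub>0"])
next
  show "\<exists>c>0::real. \<exists>C::real. \<forall>(n::nat) (s::nat) (e::nat \<Rightarrow> nat) (D::nat).
      1 \<le> s \<longrightarrow> 2 \<le> D \<longrightarrow> (\<forall>i\<in>{1..s}. e i \<le> D) \<longrightarrow>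
      C \<le> (real n / real s) powr (1 / (real D - 1)) \<longrightarrow>
      c * (real n / real s) powr (1 / (real D - 1)) \<le> real (subspace_dim n s e)"
  \<comment> \<open>A threshold is necessary: the dimension may be 0 while the root is positive, for
    instance when n = s = 1 and D = e 1 = 2.\<close>
  proof (rule exI[of _ "1 / 10"], intro conjI exI[of _ 7] allI impI)
    fix n s :: nat and e :: "nat \<Rightarrow> nat" and D :: nat
    assume "1 \<le> s" "2 \<le> D" "\<forall>i\<in>{1..s}. e i \<le> D"
      "7 \<le> (real n / real s) powr (1 / (real D - 1))"
    from subspace_dim_ge_root(2)[OF this]
    show "1 / 10 * (real n / real s) powr (1 / (real D - 1)) \<le> real (subspace_dim n s e)"
      by linarith
  qed simp
next
  show "\<exists>c>0::real. \<forall>(n::nat) (s::nat) (e::nat \<Rightarrow> nat) (D::nat).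
      1 \<le> s \<longrightarrow> 2 \<le> D \<longrightarrow> (\<forall>i\<in>{1..s}. e i \<le> D) \<longrightarrow>
      real D \<le> log 2 (real n / real s) / 10 \<longrightarrow>
      c * (real D * (real n / real s) powr (1 / (real D - 1))) \<le> real (subspace_dim n s e)"
  proof (rule exI[of _ "1 / 72"], intro conjI allI impI)
    fix n s :: nat and e :: "nat \<Rightarrow> nat" and D :: nat
    assume "1 \<le> s" "2 \<le> D" "\<forall>i\<in>{1..s}. e i \<le> D"
      "real D \<le> log 2 (real n / real s) / 10"
    from subspace_dim_ge_degree_times_root[OF this]
    show "1 / 72 * (real D * (real n / real s) powr (1 / (real D - 1)))
        \<le> real (subspace_dim n s e)"
      by linarith
  qed simp
qed

end
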